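(* Let $k$ be a positive integer, let $c_1,\ldots,c_k$ be positive rationals and let $x_1,\ldots,x_k$ be non-zero rationals. For each $i\in\{1,\ldots,k\}$ let $\varepsilon_i:=x_i\cdot|x_i|^{-1}\in\{1,-1\}$ be the sign of $x_i$. Then: (1) if the sequence $(\omega(c_1x_1^n+\cdots+c_kx_k^n))_{n\ge 1}$ is bounded, then $|x_1|=\cdots=|x_k|$; (2) if $|x_1|=\cdots=|x_k|$ and $\sum_{i=1}^k\varepsilon_i c_i\ne 0$, then the sequence $(\omega(c_1x_1^n+\cdots+c_kx_k^n))_{n\ge 1}$ is bounded.
   Context: For a non-zero integer $x$, $\omega(x)$ is the number of distinct (positive) prime divisors of $x$, and $\omega(0):=\infty$. For $x\in\mathbf Z$ and a positive integer $y$, one sets $\omega(x/y):=\omega(x/\delta)+\omega(y/\delta)$ where $\delta=\gcd(x,y)$. "Bounded" means bounded above by a finite constant. *)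

theory Defs
  imports
    Complex_Main
    "HOL-Library.Extended_Nat"
    "HOL-Computational_Algebra.Primes"
begin

(* On int, prime_factors collects the positive prime divisors, each counted once. *)
definition omega_int :: "int \<Rightarrow> enat" where
  "omega_int x = (if x = 0 then \<infinity> else enat (card (prime_factors x)))"

(* quotient_of r is the pair (x, y) with r = x / y, coprime x y and y > 0;
   omega_rat_Fract below gives the value on an arbitrary, not necessarily reduced, fraction. *)
definition omega_rat :: "rat \<Rightarrow> enat" where
  "omega_rat r = (case quotient_of r of (x, y) \<Rightarrow> omega_int x + omega_int y)"

lemma omega_rat_Fract:
  assumes "y > 0"
  shows "omega_rat (Fract x y) = omega_int (x div gcd x y) + omega_int (y div gcd x y)"
  using assms by (simp add: omega_rat_def quotient_of_Fract Rat.normalize_def Let_def)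

lemma omega_rat_of_int: "omega_rat (of_int x) = omega_int x"
  by (simp add: omega_rat_def omega_int_def zero_enat_def)

end

theory Submission
  imports Defs "HOL-Number_Theory.Residues"
begin

text \<open>
  The second part is a parity matter: if all \<open>\<bar>x i\<bar>\<close> equal \<open>r\<close>, then the \<open>n\<close>-th term is
  \<open>r ^ n\<close> times one of two non-zero constants, \<open>\<Sum>i. c i\<close> for even \<open>n\<close> and \<open>\<Sum>i. \<epsilon> i * c i\<close> for
  odd \<open>n\<close>, so that only the primes of \<open>r\<close> and of these constants can occur.

  For the first part, even exponents already suffice, and they remove the signs. Clearing
  denominators and dividing the bases by their greatest common divisor changes the set of primes
  by at most a fixed finite set, so it is enough to show that
  \<open>u n = (\<Sum>i\<in>I. b i * a i ^ n)\<close> acquires arbitrarily many primes when the \<open>a i\<close>, \<open>b i\<close> are positive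
  integers, \<open>Gcd (a ` I) = 1\<close> and some \<open>a j > 1\<close> (lemma \<open>power_sum_prime_factors_unbounded\<close>).

  This is done by forcing one new prime at a time (lemma \<open>power_sum_new_prime\<close>). Euler's theorem
  gives arbitrarily large \<open>n' > n\<close> for which every prime \<open>p\<close> that divides \<open>u n\<close> but none of the bases
  divides \<open>u n'\<close> to exactly the same power as \<open>u n\<close>. If no further prime occurred in \<open>u n'\<close>, then
  \<open>u n'\<close> would be bounded, provided the primes that divide some base contribute a bounded factor;
  but \<open>u n' > n'\<close>. Those exceptional primes are tamed by taking exponents divisible by a suitable
  \<open>N\<close>: for such a prime \<open>p\<close>, modulo a high power of \<open>p\<close> the terms with \<open>p\<close> dividing \<open>a i\<close> vanish and
  the others reduce to \<open>b i\<close>, leaving a positive number that is too small to be divisible by that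
  power (lemma \<open>not_prime_power_dvd_power_sum\<close>). Positivity of the coefficients enters here.
\<close>

section \<open>Power sums of natural numbers\<close>

definition power_sum :: "'i set \<Rightarrow> ('i \<Rightarrow> nat) \<Rightarrow> ('i \<Rightarrow> nat) \<Rightarrow> nat \<Rightarrow> nat" where
  "power_sum I b a n = (\<Sum>i\<in>I. b i * a i ^ n)"

lemma power_cong_1_totient_dvd:
  fixes a m n :: nat
  assumes "coprime a m" and "totient m dvd n"
  shows "[a ^ n = 1] (mod m)"
proof -
  obtain t where n: "n = totient m * t" using assms(2) by blast
  have "[(a ^ totient m) ^ t = 1 ^ t] (mod m)"
    using euler_theorem[OF assms(1)] by (rule cong_pow)
  then show ?thesis by (simp add: n power_mult)
qed

lemma power_sum_cong:
  assumes "\<And>i. i \<in> I \<Longrightarrow> coprime (a i) m" and "totient m dvd t"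
  shows "[power_sum I b a (n + t) = power_sum I b a n] (mod m)"
  unfolding power_sum_def
proof (rule cong_sum)
  fix i assume "i \<in> I"
  then have "[a i ^ n * a i ^ t = a i ^ n * 1] (mod m)"
    using power_cong_1_totient_dvd[OF assms] by (intro cong_mult cong_refl)
  then show "[b i * a i ^ (n + t) = b i * a i ^ n] (mod m)"
    by (intro cong_mult cong_refl) (simp add: power_add)
qed

text \<open>
  Modulo \<open>p ^ e\<close>, a power \<open>a i ^ n\<close> is \<open>0\<close> if \<open>p\<close> divides \<open>a i\<close> (because \<open>n \<ge> e\<close>) and \<open>1\<close> otherwise
  (Euler). So the power sum is congruent to a partial sum of the coefficients, which is positive
  because of the index \<open>j\<close>, and at most \<open>e < p ^ e\<close>.
\<close>

lemma not_prime_power_dvd_power_sum: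
  fixes a b :: "'i \<Rightarrow> nat" and p n e :: nat
  assumes fin: "finite I" and b: "\<And>i. i \<in> I \<Longrightarrow> b i > 0"
    and j: "j \<in> I" "\<not> p dvd a j" and p: "prime p"
    and e: "e = (\<Sum>i\<in>I. b i)" "e \<le> n" "totient (p ^ e) dvd n"
  shows "\<not> p ^ e dvd power_sum I b a n"
proof
  assume dvd: "p ^ e dvd power_sum I b a n"
  define s where "s = (\<Sum>i\<in>I. if p dvd a i then 0 else b i)"
  have "[power_sum I b a n = s] (mod p ^ e)"
    unfolding power_sum_def s_def
  proof (rule cong_sum)
    fix i assume "i \<in> I"
    show "[b i * a i ^ n = (if p dvd a i then 0 else b i)] (mod p ^ e)"
    proof (cases "p dvd a i")
      case True
      then have "p ^ e dvd a i ^ n" using e(2) by (meson dvd_power_same dvd_trans le_imp_power_dvd)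
      then show ?thesis using True by (simp add: cong_0_iff)
    next
      case False
      then have "coprime (a i) (p ^ e)"
        using prime_imp_coprime[OF p False] by (intro coprime_power_right_iff[THEN iffD2]) (simp add: coprime_commute)
      then have "[b i * a i ^ n = b i * 1] (mod p ^ e)"
        using power_cong_1_totient_dvd[OF _ e(3)] by (intro cong_mult cong_refl)
      then show ?thesis using False by simp
    qed
  qed
  then have "p ^ e dvd s" using dvd by (simp add: cong_dvd_iff)
  moreover have "s \<le> e" unfolding s_def e(1) by (intro sum_mono) simp
  moreover have "e < p ^ e"
    using less_le_trans[OF less_exp power_mono[OF prime_ge_2_nat[OF p]]] by simp
  moreover have "0 < b j" using b j by simp
  then have "s > 0" unfolding s_def using fin j by (intro sum_pos2[of I j]) auto
  ultimately show False using dvd_imp_le[of "p ^ e" s] by linarith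
qed

text \<open>
  The set \<open>S n\<close> leaves out the primes that divide a base: Euler's theorem is not available for them,
  so they might be lost in passing from \<open>n\<close> to \<open>n'\<close>. The conditions on \<open>N\<close> are those that bound
  their contribution by \<open>A ^ e\<close>. Keeping \<open>N dvd n'\<close> in the conclusion allows iteration.
\<close>

lemma power_sum_new_prime:
  fixes I :: "'i set" and a b :: "'i \<Rightarrow> nat" and n N :: nat
  defines "A \<equiv> (\<Prod>i\<in>I. a i)" and "e \<equiv> (\<Sum>i\<in>I. b i)"
  defines "S \<equiv> (\<lambda>n. {p. prime p \<and> p dvd power_sum I b a n \<and> \<not> p dvd A})"
  assumes fin: "finite I" and a: "\<And>i. i \<in> I \<Longrightarrow> a i > 0" and b: "\<And>i. i \<in> I \<Longrightarrow> b i > 0"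
    and gcd: "Gcd (a ` I) = 1" and j: "j \<in> I" "a j > 1"
    and N: "N > 0" "e dvd N" "totient (A ^ e) dvd N"
    and n: "n > 0" "N dvd n"
  shows "\<exists>n'>0. N dvd n' \<and> S n \<subset> S n'"
proof -
  let ?u = "power_sum I b a"
  have A: "A > 0" using a by (simp add: A_def prod_pos)
  have u: "m < ?u m" for m
  proof -
    have "m < 2 ^ m" by (rule less_exp)
    also have "\<dots> \<le> a j ^ m" using j by (intro power_mono) auto
    also have "\<dots> \<le> b j * a j ^ m" using b[OF j(1)] by simp
    also have "\<dots> \<le> ?u m" unfolding power_sum_def
      using fin j by (intro member_le_sum) auto
    finally show ?thesis .
  qed
  then have u0: "?u m \<noteq> 0" for m by (metis not_less_zero)
  have finS: "finite (S n)"
    by (rule finite_subset[of _ "prime_factors (?u n)"])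
       (use u0 in \<open>auto simp: S_def prime_factors_dvd\<close>)
  \<comment> \<open>The exponent is one more than the multiplicity, so that a congruence modulo \<open>R\<close> fixes the
    multiplicities exactly instead of only bounding them from below.\<close>
  define R where "R = (\<Prod>p\<in>S n. p ^ Suc (multiplicity p (?u n)))"
  have R: "R > 0" unfolding R_def by (rule prod_pos) (auto simp: S_def prime_gt_0_nat)
  \<comment> \<open>The last factor only makes \<open>n'\<close>, and with it the power sum, large enough for a contradiction.\<close>
  define t where "t = N * totient R * (?u n * A ^ e)"
  define n' where "n' = n + t"
  have n': "n' > 0" "N dvd n'" using n by (auto simp: n'_def t_def)
  have large: "?u n * A ^ e < ?u n'"
  proof -
    have "?u n * A ^ e \<le> t" using N R by (simp add: t_def Suc_le_eq)
    also have "\<dots> \<le> n'" by (simp add: n'_def)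
    finally show ?thesis using u by (rule le_less_trans)
  qed
  have cong: "[?u n' = ?u n] (mod R)"
    unfolding n'_def
  proof (rule power_sum_cong)
    fix i assume i: "i \<in> I"
    show "coprime (a i) R" unfolding R_def
    proof (rule prod_coprime_right)
      fix p assume "p \<in> S n"
      moreover have "a i dvd A" unfolding A_def using fin i by (rule dvd_prodI)
      ultimately have "prime p" "\<not> p dvd a i" by (auto simp: S_def)
      then show "coprime (a i) (p ^ Suc (multiplicity p (?u n)))"
        using prime_imp_coprime[of p "a i"]
        by (intro coprime_power_right_iff[THEN iffD2]) (simp add: coprime_commute)
    qed
  qed (simp add: t_def)
  have old: "multiplicity p (?u n') = multiplicity p (?u n)" "p dvd ?u n'" if "p \<in> S n" for p
  proof -
    have p: "prime p" "p dvd ?u n" using that by (auto simp: S_def)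
    have "p ^ Suc (multiplicity p (?u n)) dvd R" unfolding R_def
      using finS that by (rule dvd_prodI)
    then have c: "[?u n' = ?u n] (mod p ^ Suc (multiplicity p (?u n)))"
      by (rule cong_dvd_modulus_nat[OF cong])
    have dvd_iff: "p ^ k dvd ?u n' \<longleftrightarrow> p ^ k dvd ?u n" if "k \<le> Suc (multiplicity p (?u n))" for k
      using cong_dvd_iff[OF cong_dvd_modulus_nat[OF c le_imp_power_dvd[OF that]]] by simp
    have "\<not> is_unit p" using p(1) not_prime_unit by blast
    then have "\<not> p ^ Suc (multiplicity p (?u n)) dvd ?u n"
      using power_dvd_iff_le_multiplicity[OF u0] by (metis Suc_n_not_le_n)
    then show "multiplicity p (?u n') = multiplicity p (?u n)"
      using dvd_iff[OF le_SucI[OF order_refl]] dvd_iff[OF order_refl] multiplicity_dvd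
      by (intro multiplicity_eqI) blast+
    show "p dvd ?u n'" using dvd_iff[of 1] p by simp
  qed
  have "\<not> S n' \<subseteq> S n"
  proof
    assume sub: "S n' \<subseteq> S n"
    have "?u n' dvd ?u n * A ^ e"
    proof (rule multiplicity_le_imp_dvd)
      fix p :: nat assume p: "prime p"
      have mult: "multiplicity p (?u n * A ^ e) = multiplicity p (?u n) + e * multiplicity p A"
        using p u0 A by (simp add: prime_elem_multiplicity_mult_distrib prime_elem_multiplicity_power_distrib)
      consider "p dvd A" | "\<not> p dvd A" "p dvd ?u n'" | "\<not> p dvd ?u n'" by blast
      then show "multiplicity p (?u n') \<le> multiplicity p (?u n * A ^ e)"
      proof cases
        case 1
        have "\<not> p dvd Gcd (a ` I)" using gcd p by auto
        then obtain i where i: "i \<in> I" "\<not> p dvd a i" by (auto simp: dvd_Gcd_iff)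
        have "totient (p ^ e) dvd totient (A ^ e)"
          using 1 A by (intro totient_dvd dvd_power_same)
        then have "totient (p ^ e) dvd n'" using N(3) n'(2) by (meson dvd_trans)
        moreover have "e \<le> n'" using dvd_trans[OF N(2) n'(2)] n'(1) by (rule dvd_imp_le)
        ultimately have "\<not> p ^ e dvd ?u n'"
          using fin b i p e_def by (intro not_prime_power_dvd_power_sum[where j = i]) auto
        then have "multiplicity p (?u n') < e"
          using multiplicity_dvd'[of e p "?u n'"] by linarith
        moreover have "multiplicity p A \<ge> 1"
          using 1 A multiplicity_gt_zero_iff[of A p] prime_gt_1_nat[OF p] by (auto simp: Suc_le_eq)
        then have "e \<le> e * multiplicity p A" by simp
        ultimately show ?thesis using mult by linarith
      next
        case 2
        then have "p \<in> S n" using p sub by (auto simp: S_def)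
        then show ?thesis using mult old by simp
      next
        case 3
        then show ?thesis by (simp add: not_dvd_imp_multiplicity_0)
      qed
    qed (rule u0)
    then have "?u n' \<le> ?u n * A ^ e" using u0 A by (intro dvd_imp_le) auto
    then show False using large by simp
  qed
  moreover have "S n \<subseteq> S n'" using old by (auto simp: S_def)
  ultimately show ?thesis using n' by blast
qed

theorem power_sum_prime_factors_unbounded:
  fixes a b :: "'i \<Rightarrow> nat"
  assumes fin: "finite I" and a: "\<And>i. i \<in> I \<Longrightarrow> a i > 0" and b: "\<And>i. i \<in> I \<Longrightarrow> b i > 0"
    and gcd: "Gcd (a ` I) = 1" and j: "j \<in> I" "a j > 1"
  shows "\<exists>n>0. even n \<and> K \<le> card (prime_factors (power_sum I b a n))"
proof -
  define A where "A = (\<Prod>i\<in>I. a i)"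
  define e where "e = (\<Sum>i\<in>I. b i)"
  define S where "S = (\<lambda>n. {p. prime p \<and> p dvd power_sum I b a n \<and> \<not> p dvd A})"
  \<comment> \<open>The factor \<open>2\<close> makes the exponents even; the others are what the induction step requires.\<close>
  define N where "N = 2 * e * totient (A ^ e)"
  have "0 < b j" using b j by simp
  then have "e > 0" unfolding e_def using fin j by (intro sum_pos2[of I j]) auto
  moreover have "A > 0" using a by (simp add: A_def prod_pos)
  ultimately have N: "N > 0" by (simp add: N_def)
  have "0 < b j * a j ^ n" for n using b j by simp
  then have u0: "power_sum I b a n > 0" for n
    unfolding power_sum_def using fin j by (intro sum_pos2[of I j]) auto
  have sub: "S n \<subseteq> prime_factors (power_sum I b a n)" for n
    using u0[of n] by (auto simp: S_def prime_factors_dvd)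
  then have finS: "finite (S n)" for n by (rule finite_subset) simp
  have "\<exists>n>0. N dvd n \<and> K \<le> card (S n)"
  proof (induction K)
    case 0
    then show ?case using N by auto
  next
    case (Suc K)
    then obtain n where n: "n > 0" "N dvd n" "K \<le> card (S n)" by blast
    have "\<exists>n'>0. N dvd n' \<and> S n \<subset> S n'"
      unfolding S_def A_def
      by (rule power_sum_new_prime[OF fin a b gcd j N _ _ n(1,2)])
         (simp_all add: N_def A_def e_def)
    then obtain n' where n': "n' > 0" "N dvd n'" "S n \<subset> S n'" by blast
    then have "card (S n) < card (S n')" using finS by (intro psubset_card_mono) auto
    then show ?case using n n' by (metis Suc_leI le_less_trans)
  qed
  then obtain n where n: "n > 0" "N dvd n" "K \<le> card (S n)" by blast
  have "card (S n) \<le> card (prime_factors (power_sum I b a n))"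
    using sub by (intro card_mono) auto
  moreover have "even n" using n(2) by (auto simp: N_def)
  ultimately show ?thesis using n by (meson order_trans)
qed

section \<open>The primes occurring in a rational number\<close>

text \<open>
  As numerator and denominator are coprime, \<open>omega_rat r\<close> counts this set for \<open>r \<noteq> 0\<close>. Working
  with sets has the advantage that cancellation in a product can only remove primes, so products
  and powers obey simple inclusions.
\<close>

definition prime_support :: "rat \<Rightarrow> int set" where
  "prime_support r = (case quotient_of r of (x, y) \<Rightarrow> prime_factors (x * y))"

lemma finite_prime_support [simp]: "finite (prime_support r)"
  by (simp add: prime_support_def split: prod.split)

lemma omega_rat_eq_card_prime_support:
  assumes "r \<noteq> 0"
  shows "omega_rat r = enat (card (prime_support r))"
proof -
  obtain x y where q: "quotient_of r = (x, y)" by fastforce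
  have y: "y > 0" using q by (rule quotient_of_denom_pos)
  have cop: "coprime x y" using q by (rule quotient_of_coprime)
  have x: "x \<noteq> 0" using quotient_of_div[OF q] assms by auto
  have "prime_factors x \<inter> prime_factors y = {}"
    using cop by (auto simp: prime_factors_dvd dest: coprime_common_divisor not_prime_unit)
  then have "card (prime_support r) = card (prime_factors x) + card (prime_factors y)"
    using x y q by (simp add: prime_support_def prime_factors_product card_Un_disjoint)
  then show ?thesis using x y q by (simp add: omega_rat_def omega_int_def)
qed

lemma prime_support_of_int: "prime_support (of_int x) = prime_factors x"
  by (simp add: prime_support_def)

lemma prime_support_of_nat: "prime_support (of_nat m) = int ` prime_factors m"
proof -
  have "p \<in> int ` prime_factors m" if "p \<in> prime_factors (int m)" for p
  proof -
    have "p > 0" using that by (rule prime_factors_gt_0_int)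
    then obtain q where "p = int q" using zero_less_imp_eq_int by blast
    then show ?thesis using that by (auto simp: in_prime_factors_iff)
  qed
  then have "prime_factors (int m) = int ` prime_factors m"
    by (auto simp: in_prime_factors_iff)
  then show ?thesis using prime_support_of_int[of "int m"] by simp
qed

lemma prime_support_divide_of_int_subset:
  assumes "x \<noteq> 0" "y \<noteq> 0"
  shows "prime_support (of_int x / of_int y) \<subseteq> prime_factors (x * y)"
proof -
  obtain x' y' where q: "quotient_of (of_int x / of_int y) = (x', y')" by fastforce
  have y': "y' > 0" using q by (rule quotient_of_denom_pos)
  have cop: "coprime x' y'" using q by (rule quotient_of_coprime)
  have "(of_int x / of_int y :: rat) = of_int x' / of_int y'" using q by (rule quotient_of_div)
  then have "(of_int (x * y') :: rat) = of_int (x' * y)"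
    using assms y' by (simp add: field_simps)
  then have eq: "x * y' = x' * y" by (simp only: of_int_eq_iff)
  have "x' dvd x * y'" "y' dvd x' * y" using eq by (metis dvd_triv_left dvd_triv_right)+
  then have "x' dvd x" "y' dvd y"
    using cop by (simp_all add: coprime_dvd_mult_left_iff coprime_dvd_mult_right_iff coprime_commute)
  then have "x' * y' dvd x * y" by (rule mult_dvd_mono)
  then show ?thesis using assms q by (simp add: prime_support_def dvd_prime_factors)
qed

lemma prime_support_mult_subset:
  assumes "r \<noteq> 0" "s \<noteq> 0"
  shows "prime_support (r * s) \<subseteq> prime_support r \<union> prime_support s"
proof -
  obtain x y where q: "quotient_of r = (x, y)" by fastforce
  obtain z w where q': "quotient_of s = (z, w)" by fastforce
  have yw: "y > 0" "w > 0" using q q' quotient_of_denom_pos by blast+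
  have r: "r = of_int x / of_int y" "s = of_int z / of_int w"
    using q q' quotient_of_div by blast+
  then have xz: "x \<noteq> 0" "z \<noteq> 0" using assms by auto
  have "r * s = of_int (x * z) / of_int (y * w)" using r by simp
  then have "prime_support (r * s) \<subseteq> prime_factors ((x * z) * (y * w))"
    using prime_support_divide_of_int_subset[of "x * z" "y * w"] xz yw by simp
  also have "\<dots> = prime_factors (x * y) \<union> prime_factors (z * w)"
    using xz yw by (auto simp: prime_factors_product)
  finally show ?thesis using q q' by (simp add: prime_support_def)
qed

lemma prime_support_power_subset:
  assumes "r \<noteq> 0"
  shows "prime_support (r ^ n) \<subseteq> prime_support r"
proof (induction n)
  case 0
  then show ?case using prime_support_of_int[of 1] by simp
next
  case (Suc n)
  then show ?case using prime_support_mult_subset[of r "r ^ n"] assms by auto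
qed

lemma common_denominator:
  fixes f :: "'i \<Rightarrow> rat"
  assumes "finite I" and "\<And>i. i \<in> I \<Longrightarrow> f i > 0"
  obtains d :: nat and g :: "'i \<Rightarrow> nat"
  where "d > 0" and "\<And>i. i \<in> I \<Longrightarrow> g i > 0" and "\<And>i. i \<in> I \<Longrightarrow> f i = of_nat (g i) / of_nat d"
proof -
  define den where "den i = snd (quotient_of (f i))" for i
  define num where "num i = fst (quotient_of (f i))" for i
  have den: "den i > 0" for i by (simp add: den_def quotient_of_denom_pos')
  have f: "f i = of_int (num i) / of_int (den i)" for i
    by (simp add: den_def num_def quotient_of_div)
  define D where "D = (\<Prod>i\<in>I. den i)"
  have D: "D > 0" by (simp add: D_def den prod_pos)
  show ?thesis
  proof
    show "nat D > 0" using D by simp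
  next
    fix i assume i: "i \<in> I"
    have "den i dvd D" unfolding D_def using assms(1) i by (rule dvd_prodI)
    then obtain m where m: "D = den i * m" by blast
    then have m0: "m > 0" using D den[of i] by (simp add: zero_less_mult_iff)
    have num: "num i > 0"
      using assms(2)[OF i] den[of i] f[of i] by (simp add: zero_less_divide_iff)
    have quot: "num i * (D div den i) = num i * m" using den[of i] m by simp
    show "nat (num i * (D div den i)) > 0" using quot num m0 by simp
    show "f i = of_nat (nat (num i * (D div den i))) / of_nat (nat D)"
      using quot num m0 D den[of i] m by (simp add: f[of i])
  qed
qed

section \<open>Weighted power sums of rational numbers\<close>

text \<open>
  Write \<open>\<bar>x i\<bar> = a i / q\<close> and \<open>c i = b i / D\<close> with natural numbers \<open>a i\<close> of greatest common divisor \<open>1\<close>.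
  For even \<open>n\<close> the integral power sum is \<open>D * q ^ n\<close> times the given one, and \<open>D * q ^ n\<close> involves
  only primes from a finite set that does not depend on \<open>n\<close>.
\<close>

lemma abs_eq_of_omega_rat_bounded:
  fixes c x :: "'i \<Rightarrow> rat"
  assumes fin: "finite I" and c: "\<And>i. i \<in> I \<Longrightarrow> c i > 0" and x: "\<And>i. i \<in> I \<Longrightarrow> x i \<noteq> 0"
    and bounded: "\<And>n. n \<ge> 1 \<Longrightarrow> omega_rat (\<Sum>i\<in>I. c i * x i ^ n) \<le> enat B"
    and ij: "i \<in> I" "j \<in> I"
  shows "\<bar>x i\<bar> = \<bar>x j\<bar>"
proof (rule ccontr)
  assume neq: "\<bar>x i\<bar> \<noteq> \<bar>x j\<bar>"
  obtain d h where d: "d > 0" and h: "\<And>i. i \<in> I \<Longrightarrow> h i > 0"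
    and xh: "\<And>i. i \<in> I \<Longrightarrow> \<bar>x i\<bar> = of_nat (h i) / of_nat d"
    using common_denominator[OF fin, of "\<lambda>i. \<bar>x i\<bar>"] x by (metis zero_less_abs_iff)
  obtain D b where D: "D > 0" and b: "\<And>i. i \<in> I \<Longrightarrow> b i > 0"
    and cb: "\<And>i. i \<in> I \<Longrightarrow> c i = of_nat (b i) / of_nat D"
    using common_denominator[OF fin, of c] c by metis
  define g where "g = Gcd (h ` I)"
  have "g dvd h i" using ij by (simp add: g_def)
  then have g: "g > 0" using h[OF ij(1)] by (auto intro!: Nat.gr0I)
  define a where "a i = h i div g" for i
  have ha: "h i = g * a i" if "i \<in> I" for i
    using that by (simp add: a_def g_def)
  have a: "a i > 0" if "i \<in> I" for i using h[OF that] ha[OF that] by (auto intro!: Nat.gr0I)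
  have gcd: "Gcd (a ` I) = 1"
  proof -
    have "h ` I = (*) g ` (a ` I)" using ha by (auto simp: image_image)
    then have "g = g * Gcd (a ` I)" using Gcd_mult[of g "a ` I"] by (simp add: g_def)
    then show ?thesis using g by simp
  qed
  define q where "q = (of_nat d / of_nat g :: rat)"
  have q: "q \<noteq> 0" using d g by (simp add: q_def)
  have aq: "of_nat (a i) = \<bar>x i\<bar> * q" if "i \<in> I" for i
    using that xh ha d g by (simp add: q_def)
  have "a i \<noteq> a j" using neq aq[OF ij(1)] aq[OF ij(2)] q by auto
  then obtain l where l: "l \<in> I" "a l > 1"
    using a ij by (metis less_one linorder_neqE_nat nat_neq_iff)
  let ?F = "prime_support (of_nat D) \<union> prime_support q"
  obtain n where n: "n > 0" "even n" "card ?F + B + 1 \<le> card (prime_factors (power_sum I b a n))"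
  proof -
    have "\<exists>n>0. even n \<and> card ?F + B + 1 \<le> card (prime_factors (power_sum I b a n))"
      by (rule power_sum_prime_factors_unbounded[OF fin _ _ gcd l]) (use a b in auto)
    then show ?thesis using that by blast
  qed
  define u where "u = (\<Sum>i\<in>I. c i * x i ^ n)"
  have "0 < c i * x i ^ n" if "i \<in> I" for i
    using c x that n(2) by (simp add: zero_less_power_eq)
  then have u: "u > 0" unfolding u_def using fin ij by (intro sum_pos) auto
  have eq: "of_nat (power_sum I b a n) = of_nat D * q ^ n * u"
  proof -
    have "of_nat (b i * a i ^ n) = of_nat D * q ^ n * (c i * x i ^ n)" if "i \<in> I" for i
      using cb[OF that] aq[OF that] D n(2) by (simp add: power_mult_distrib power_even_abs)
    then show ?thesis by (simp add: power_sum_def u_def sum_distrib_left)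
  qed
  have "prime_support (of_nat (power_sum I b a n)) \<subseteq> ?F \<union> prime_support u"
    unfolding eq
    using prime_support_mult_subset[of "of_nat D * q ^ n" u] prime_support_mult_subset[of "of_nat D" "q ^ n"]
      prime_support_power_subset[of q n] D q u by auto
  then have "card (prime_support (of_nat (power_sum I b a n))) \<le> card (?F \<union> prime_support u)"
    by (intro card_mono) auto
  also have "\<dots> \<le> card ?F + card (prime_support u)" by (rule card_Un_le)
  also have "card (prime_support u) \<le> B"
    using bounded[of n] n(1) omega_rat_eq_card_prime_support[of u] u by (simp add: u_def)
  finally have "card (prime_support (of_nat (power_sum I b a n))) \<le> card ?F + B" by simp
  then have "card (prime_factors (power_sum I b a n)) \<le> card ?F + B"
    by (simp add: prime_support_of_nat card_image)
  then show False using n(3) by simp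
qed

text \<open>
  The value is \<open>s n * r ^ n\<close>, where \<open>s n\<close> depends only on the parity of \<open>n\<close>. Positivity of the
  coefficients gives \<open>s 0 \<noteq> 0\<close>, while \<open>s 1 \<noteq> 0\<close> is the hypothesis on the signed sum.
\<close>

lemma omega_rat_bounded_of_abs_eq:
  fixes c x :: "'i \<Rightarrow> rat"
  assumes fin: "finite I" and "I \<noteq> {}" and c: "\<And>i. i \<in> I \<Longrightarrow> c i > 0"
    and r: "r > 0" "\<And>i. i \<in> I \<Longrightarrow> \<bar>x i\<bar> = r"
    and nz: "(\<Sum>i\<in>I. sgn (x i) * c i) \<noteq> 0"
  shows "\<exists>B. \<forall>n\<ge>1. omega_rat (\<Sum>i\<in>I. c i * x i ^ n) \<le> enat B"
proof -
  define s where "s n = (\<Sum>i\<in>I. c i * sgn (x i) ^ n)" for n :: nat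
  have u: "(\<Sum>i\<in>I. c i * x i ^ n) = s n * r ^ n" for n
  proof -
    have "x i ^ n = sgn (x i) ^ n * r ^ n" if "i \<in> I" for i
      using r(2)[OF that] by (metis mult_sgn_abs power_mult_distrib)
    then show ?thesis by (simp add: s_def sum_distrib_right mult.assoc)
  qed
  have sgn2: "sgn (x i) ^ 2 = 1" if "i \<in> I" for i
    using r(1) r(2)[OF that] by (auto simp: sgn_if)
  have s: "s n = s (n mod 2)" for n
  proof -
    have "sgn (x i) ^ n = sgn (x i) ^ (n mod 2)" if "i \<in> I" for i
    proof -
      have "sgn (x i) ^ n = sgn (x i) ^ (2 * (n div 2) + n mod 2)" by simp
      also have "\<dots> = sgn (x i) ^ (n mod 2)" by (simp only: power_add power_mult sgn2[OF that]) simp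
      finally show ?thesis .
    qed
    then show ?thesis by (simp add: s_def)
  qed
  have "s 0 > 0" using c fin \<open>I \<noteq> {}\<close> by (simp add: s_def sum_pos)
  moreover have "s 1 \<noteq> 0" using nz by (simp add: s_def mult.commute)
  ultimately have s0: "s n \<noteq> 0" for n using s[of n] by (cases "even n") (auto simp: odd_iff_mod_2_eq_one)
  let ?F = "prime_support (s 0) \<union> prime_support (s 1) \<union> prime_support r"
  have "omega_rat (\<Sum>i\<in>I. c i * x i ^ n) \<le> enat (card ?F)" for n
  proof -
    have "prime_support (s n) \<subseteq> prime_support (s 0) \<union> prime_support (s 1)"
      using s[of n] by (cases "even n") (auto simp: odd_iff_mod_2_eq_one)
    then have "prime_support (s n * r ^ n) \<subseteq> ?F"
      using prime_support_mult_subset[of "s n" "r ^ n"] prime_support_power_subset[of r n] s0 r(1) by auto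
    then have "card (prime_support (s n * r ^ n)) \<le> card ?F" by (intro card_mono) auto
    then show ?thesis using omega_rat_eq_card_prime_support[of "s n * r ^ n"] s0 r(1) by (simp add: u)
  qed
  then show ?thesis by blast
qed

section \<open>Bounded numbers of prime factors\<close>

theorem corollary3:
  fixes k :: nat and c x \<epsilon> :: "nat \<Rightarrow> rat"
  assumes "k \<ge> 1"
    and "\<forall>i\<in>{1..k}. c i > 0"
    and "\<forall>i\<in>{1..k}. x i \<noteq> 0"
    and "\<forall>i\<in>{1..k}. \<epsilon> i = x i * inverse \<bar>x i\<bar>"
  shows "((\<exists>B::nat. \<forall>n::nat\<ge>1. omega_rat (\<Sum>i=1..k. c i * x i ^ n) \<le> enat B)
            \<longrightarrow> (\<forall>i\<in>{1..k}. \<forall>j\<in>{1..k}. \<bar>x i\<bar> = \<bar>x j\<bar>))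
       \<and> ((\<forall>i\<in>{1..k}. \<forall>j\<in>{1..k}. \<bar>x i\<bar> = \<bar>x j\<bar>) \<and> (\<Sum>i=1..k. \<epsilon> i * c i) \<noteq> 0
            \<longrightarrow> (\<exists>B::nat. \<forall>n::nat\<ge>1. omega_rat (\<Sum>i=1..k. c i * x i ^ n) \<le> enat B))"
proof (intro conjI impI)
  assume "\<exists>B::nat. \<forall>n::nat\<ge>1. omega_rat (\<Sum>i=1..k. c i * x i ^ n) \<le> enat B"
  then show "\<forall>i\<in>{1..k}. \<forall>j\<in>{1..k}. \<bar>x i\<bar> = \<bar>x j\<bar>"
    using abs_eq_of_omega_rat_bounded[of "{1..k}" c x] assms(2,3) by blast
next
  assume *: "(\<forall>i\<in>{1..k}. \<forall>j\<in>{1..k}. \<bar>x i\<bar> = \<bar>x j\<bar>) \<and> (\<Sum>i=1..k. \<epsilon> i * c i) \<noteq> 0"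
  have "\<epsilon> i = sgn (x i)" if "i \<in> {1..k}" for i
    using assms(3,4) that by (auto simp: sgn_if abs_if)
  then have "(\<Sum>i=1..k. sgn (x i) * c i) \<noteq> 0" using * by simp
  then show "\<exists>B::nat. \<forall>n::nat\<ge>1. omega_rat (\<Sum>i=1..k. c i * x i ^ n) \<le> enat B"
  proof (intro omega_rat_bounded_of_abs_eq[where r = "\<bar>x 1\<bar>"])
    have 1: "1 \<in> {1..k}" using assms(1) by simp
    then show "{1..k} \<noteq> {}" by blast
    show "\<bar>x 1\<bar> > 0" using assms(3) 1 by simp
    show "\<bar>x i\<bar> = \<bar>x 1\<bar>" if "i \<in> {1..k}" for i using * 1 that by blast
  qed (use assms(2) in auto)
qed

end
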